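(* Let $N\ge1$ be an integer and $b_1,\dots,b_N\in\mathbb{Q}$ with $b_N\neq0$. Let \[R(x_1,\dots,x_N):=(1+x_1)^{b_1}(1+x_1+x_2)^{b_2}\cdots(1+x_1+\dots+x_N)^{b_N}.\] For $k=1,\dots,N$ let $B(k):=-(b_k+\dots+b_N)$ and \[u^k:=\left(\tfrac{B(k)}{N-k+1},\tfrac{B(k)+1}{N-k+1},\dots,\tfrac{B(k)+N-k}{N-k+1}\right);\] for $k=1,\dots,N-1$ let \[v^k:=\left(\tfrac{B(k)}{N-k},\tfrac{B(k)+1}{N-k},\dots,\tfrac{B(k)+N-k-1}{N-k}\right),\] and let $v^N:=(1,\dots,1)$ consist of exactly $N-1$ ones. Let $u:=(u^1,\dots,u^N)$ (of length $M:=N(N+1)/2$) and $v:=(v^1,\dots,v^N)$ (of length $M-1$). Then \[\operatorname{Diag}(R(x_1,\dots,x_N))={}_MF_{M-1}(u;v;(-N)^Nt).\]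
   Context: All power series have coefficients in $\mathbb{Q}$. For $a\in\mathbb{Q}$ and a power series $L$ with zero constant term, $(1+L)^a:=\sum_{j\ge0}\binom{a}{j}L^j$ with $\binom{a}{j}=a(a-1)\cdots(a-j+1)/j!$. For $g=\sum g_{i_1,\dots,i_N}x_1^{i_1}\cdots x_N^{i_N}$, $\operatorname{Diag}(g):=\sum_{j\ge0}g_{j,\dots,j}t^j$. For tuples $u=(a_1,\dots,a_p)$, $v=(b_1,\dots,b_q)$, ${}_pF_q(u;v;t):=\sum_{j\ge0}\frac{(a_1)_j\cdots(a_p)_j}{(b_1)_j\cdots(b_q)_j}\frac{t^j}{j!}$ with $(x)_j=x(x+1)\cdots(x+j-1)$, defined when no $b_i+j$ ($j\in\mathbb{N}$) vanishes. *)

theory Defs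
  imports
    "HOL-Computational_Algebra.Formal_Power_Series"
    "HOL-Library.Poly_Mapping"
begin

section \<open>Multivariate formal power series\<close>

text \<open>
  Power series over the coefficients \<open>'a\<close> in variables indexed by the type \<open>'v\<close>. An exponent is a
  finitely supported map \<open>'v \<Rightarrow>\<^sub>0 nat\<close>. Series in \<open>x\<^sub>1, \<dots>, x\<^sub>N\<close> are the elements of
  \<open>(nat, 'a) mfps\<close> that involve only the variables with index in \<open>{1..N}\<close>, so that one type
  serves all \<open>N\<close>.
\<close>

typedef ('v, 'a) mfps = "UNIV :: (('v \<Rightarrow>\<^sub>0 nat) \<Rightarrow> 'a) set"
  morphisms mfps_coeff Abs_mfps ..

setup_lifting type_definition_mfps

lemma mfps_eqI: "(\<And>m. mfps_coeff f m = mfps_coeff g m) \<Longrightarrow> f = g"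
  by (metis ext mfps_coeff_inject)

definition mdegree :: "('v \<Rightarrow>\<^sub>0 nat) \<Rightarrow> nat" where
  "mdegree m = (\<Sum>i\<in>Poly_Mapping.keys m. Poly_Mapping.lookup m i)"

lemma mdegree_superset:
  assumes "finite A" "Poly_Mapping.keys m \<subseteq> A"
  shows "mdegree m = (\<Sum>i\<in>A. Poly_Mapping.lookup m i)"
  unfolding mdegree_def using assms
  by (intro sum.mono_neutral_left) (auto simp: in_keys_iff)

lemma mdegree_add: "mdegree (p + q) = mdegree p + mdegree q"
proof -
  let ?A = "Poly_Mapping.keys p \<union> Poly_Mapping.keys q"
  have "mdegree (p + q) = (\<Sum>i\<in>?A. Poly_Mapping.lookup (p + q) i)"
    by (rule mdegree_superset) (auto dest: subsetD[OF Poly_Mapping.keys_add])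
  also have "\<dots> = (\<Sum>i\<in>?A. Poly_Mapping.lookup p i) + (\<Sum>i\<in>?A. Poly_Mapping.lookup q i)"
    by (simp add: lookup_add sum.distrib)
  also have "\<dots> = mdegree p + mdegree q"
    by (subst (1 2) mdegree_superset[of ?A]) auto
  finally show ?thesis .
qed

lemma mdegree_eq_0_iff: "mdegree m = 0 \<longleftrightarrow> m = 0"
proof
  assume "mdegree m = 0"
  then have "\<forall>i\<in>Poly_Mapping.keys m. Poly_Mapping.lookup m i = 0"
    by (simp add: mdegree_def)
  then show "m = 0"
    by (auto intro!: poly_mapping_eqI simp: in_keys_iff)
qed (simp add: mdegree_def)

abbreviation splits :: "('v \<Rightarrow>\<^sub>0 nat) \<Rightarrow> (('v \<Rightarrow>\<^sub>0 nat) \<times> ('v \<Rightarrow>\<^sub>0 nat)) set" where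
  "splits m \<equiv> {(p, q). p + q = m}"

lemma finite_splits [simp]: "finite (splits (m :: 'v \<Rightarrow>\<^sub>0 nat))"
proof -
  let ?F = "{f. \<forall>i. (i \<in> Poly_Mapping.keys m \<longrightarrow> f i \<in> {..mdegree m}) \<and>
                    (i \<notin> Poly_Mapping.keys m \<longrightarrow> f i = (0::nat))}"
  let ?D = "{p. Poly_Mapping.lookup p \<in> ?F}"
  have fin: "finite ?F"
    by (rule finite_set_of_finite_funs) auto
  have "inj_on Poly_Mapping.lookup ?D"
    by (auto intro!: inj_onI poly_mapping_eqI)
  moreover have "finite (Poly_Mapping.lookup ` ?D)"
    by (rule finite_subset[OF _ fin]) auto
  ultimately have finD: "finite ?D"
    using finite_imageD by blast
  have le: "Poly_Mapping.lookup m i \<le> mdegree m" for i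
  proof (cases "i \<in> Poly_Mapping.keys m")
    case True
    then show ?thesis
      unfolding mdegree_def by (intro member_le_sum) auto
  qed (simp add: in_keys_iff)
  have mem: "p \<in> ?D" if "p + q = m" for p q
  proof -
    have eq: "Poly_Mapping.lookup p i + Poly_Mapping.lookup q i = Poly_Mapping.lookup m i" for i
      using that by (metis lookup_add)
    have "Poly_Mapping.lookup p i \<le> mdegree m" for i
      using eq[of i] le[of i] by linarith
    moreover have "Poly_Mapping.lookup p i = 0" if "i \<notin> Poly_Mapping.keys m" for i
      using eq[of i] that by (simp add: in_keys_iff)
    ultimately show ?thesis by simp
  qed
  have "splits m \<subseteq> ?D \<times> ?D"
  proof
    fix s assume "s \<in> splits m"
    then have "fst s + snd s = m" "snd s + fst s = m"
      by (auto simp: add.commute)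
    then have "fst s \<in> ?D" "snd s \<in> ?D"
      using mem by blast+
    then show "s \<in> ?D \<times> ?D"
      by (simp add: mem_Times_iff)
  qed
  then show ?thesis
    using finD by (meson finite_SigmaI finite_subset)
qed

instantiation mfps :: (type, comm_ring_1) comm_ring_1
begin

lift_definition zero_mfps :: "('a, 'b) mfps" is "\<lambda>_. 0" .

lift_definition one_mfps :: "('a, 'b) mfps" is "\<lambda>m. if m = 0 then 1 else 0" .

lift_definition plus_mfps :: "('a, 'b) mfps \<Rightarrow> ('a, 'b) mfps \<Rightarrow> ('a, 'b) mfps"
  is "\<lambda>f g m. f m + g m" .

lift_definition uminus_mfps :: "('a, 'b) mfps \<Rightarrow> ('a, 'b) mfps" is "\<lambda>f m. - f m" .

lift_definition minus_mfps :: "('a, 'b) mfps \<Rightarrow> ('a, 'b) mfps \<Rightarrow> ('a, 'b) mfps"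
  is "\<lambda>f g m. f m - g m" .

lift_definition times_mfps :: "('a, 'b) mfps \<Rightarrow> ('a, 'b) mfps \<Rightarrow> ('a, 'b) mfps"
  is "\<lambda>f g m. \<Sum>(p, q)\<in>splits m. f p * g q" .

instance
proof
  fix f g h :: "('a, 'b) mfps"
  show "f + g + h = f + (g + h)" by transfer (simp add: add.assoc)
  show "f + g = g + f" by transfer (simp add: add.commute)
  show "0 + f = f" by transfer simp
  show "- f + f = 0" by transfer simp
  show "f - g = f + - g" by transfer simp
  show "(0 :: ('a, 'b) mfps) \<noteq> 1" by transfer (metis zero_neq_one)
  show "(f + g) * h = f * h + g * h"
    by transfer (simp add: distrib_right sum.distrib case_prod_unfold)
  show "f * g = g * f"
  proof (rule mfps_eqI)
    fix m
    show "mfps_coeff (f * g) m = mfps_coeff (g * f) m"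
      unfolding times_mfps.rep_eq
      by (rule sum.reindex_bij_witness[where i = prod.swap and j = prod.swap])
        (auto simp: add.commute mult.commute)
  qed
  show "1 * f = f"
  proof (rule mfps_eqI)
    fix m
    have "mfps_coeff (1 * f) m = (\<Sum>(p, q)\<in>{(0, m)}. mfps_coeff 1 p * mfps_coeff f q)"
      unfolding times_mfps.rep_eq
      by (rule sum.mono_neutral_right) (auto simp: one_mfps.rep_eq split: if_splits)
    then show "mfps_coeff (1 * f) m = mfps_coeff f m"
      by (simp add: one_mfps.rep_eq)
  qed
  show "f * g * h = f * (g * h)"
  proof (rule mfps_eqI)
    fix m
    let ?f = "mfps_coeff f" and ?g = "mfps_coeff g" and ?h = "mfps_coeff h"
    have "mfps_coeff (f * g * h) m =
        (\<Sum>s\<in>splits m. \<Sum>r\<in>splits (fst s). ?f (fst r) * ?g (snd r) * ?h (snd s))"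
      by (simp add: times_mfps.rep_eq sum_distrib_right case_prod_unfold)
    also have "\<dots> = (\<Sum>(s, r)\<in>Sigma (splits m) (\<lambda>s. splits (fst s)).
        ?f (fst r) * ?g (snd r) * ?h (snd s))"
      by (rule sum.Sigma) auto
    also have "\<dots> = (\<Sum>(s, r)\<in>Sigma (splits m) (\<lambda>s. splits (snd s)).
        ?f (fst s) * (?g (fst r) * ?h (snd r)))"
      by (rule sum.reindex_bij_witness[where
            i = "\<lambda>((p, _), (q, r)). ((p + q, r), (p, q))" and
            j = "\<lambda>((_, r), (p, q)). ((p, q + r), (q, r))"])
        (auto simp: algebra_simps)
    also have "\<dots> = (\<Sum>s\<in>splits m. \<Sum>r\<in>splits (snd s). ?f (fst s) * (?g (fst r) * ?h (snd r)))"
      by (rule sum.Sigma[symmetric]) auto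
    also have "\<dots> = mfps_coeff (f * (g * h)) m"
      by (simp add: times_mfps.rep_eq sum_distrib_left case_prod_unfold)
    finally show "mfps_coeff (f * g * h) m = mfps_coeff (f * (g * h)) m" .
  qed
qed

end

lift_definition mfps_var :: "'v \<Rightarrow> ('v, 'a :: comm_ring_1) mfps"
  is "\<lambda>i m. if m = Poly_Mapping.single i 1 then 1 else 0" .

text \<open>
  \<open>f\<^sup>a = \<Sum>\<^sub>j (a gchoose j) (f - 1)\<^sup>j\<close>, for \<open>f\<close> with constant term 1. The sum is taken coefficientwise;
  by \<open>mfps_coeff_rpower\<close> below only finitely many \<open>j\<close> contribute to each coefficient.
\<close>

definition mfps_rpower :: "('v, 'a :: field_char_0) mfps \<Rightarrow> 'a \<Rightarrow> ('v, 'a) mfps" where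
  "mfps_rpower f a =
     Abs_mfps (\<lambda>m. Sum_any (\<lambda>j. (a gchoose j) * mfps_coeff ((f - 1) ^ j) m))"

lemma mfps_coeff_power_eq_0:
  assumes "mfps_coeff L 0 = 0" "mdegree m < j"
  shows "mfps_coeff (L ^ j) m = 0"
  using assms(2)
proof (induction j arbitrary: m)
  case (Suc j)
  have "mfps_coeff L p * mfps_coeff (L ^ j) q = 0" if "p + q = m" for p q
  proof (cases "p = 0")
    case False
    then have "mdegree q < j"
      using Suc.prems that mdegree_add[of p q] mdegree_eq_0_iff[of p] by auto
    then show ?thesis using Suc.IH by simp
  qed (simp add: assms(1))
  then show ?case
    by (auto simp: times_mfps.rep_eq intro!: sum.neutral)
qed simp

lemma mfps_coeff_rpower:
  assumes "mfps_coeff f 0 = 1"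
  shows "mfps_coeff (mfps_rpower f a) m =
           (\<Sum>j\<le>mdegree m. (a gchoose j) * mfps_coeff ((f - 1) ^ j) m)"
proof -
  have "mfps_coeff (f - 1) 0 = 0"
    using assms by (simp add: minus_mfps.rep_eq one_mfps.rep_eq)
  then have "j \<le> mdegree m" if "(a gchoose j) * mfps_coeff ((f - 1) ^ j) m \<noteq> 0" for j
    using that mfps_coeff_power_eq_0 by (metis linorder_not_le mult_zero_right)
  then show ?thesis
    unfolding mfps_rpower_def
    by (subst Abs_mfps_inverse, simp, subst Sum_any.expand_superset[of "{..mdegree m}"]) auto
qed

text \<open>The diagonal of a series in the variables with index in the finite set \<open>V\<close>.\<close>

definition mfps_diag :: "'v set \<Rightarrow> ('v, 'a :: comm_ring_1) mfps \<Rightarrow> 'a fps" where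
  "mfps_diag V g = Abs_fps (\<lambda>j. mfps_coeff g (\<Sum>i\<in>V. Poly_Mapping.single i j))"


section \<open>The hypergeometric parameters\<close>

definition diag_R :: "nat \<Rightarrow> (nat \<Rightarrow> rat) \<Rightarrow> (nat, rat) mfps" where
  "diag_R N b = (\<Prod>k=1..N. mfps_rpower (1 + (\<Sum>i=1..k. mfps_var i)) (b k))"

definition param_B :: "nat \<Rightarrow> (nat \<Rightarrow> rat) \<Rightarrow> nat \<Rightarrow> rat" where
  "param_B N b k = - (\<Sum>i=k..N. b i)"

definition u_block :: "nat \<Rightarrow> (nat \<Rightarrow> rat) \<Rightarrow> nat \<Rightarrow> rat list" where
  "u_block N b k = map (\<lambda>i. (param_B N b k + of_nat i) / of_nat (N - k + 1)) [0..<N - k + 1]"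

definition v_block :: "nat \<Rightarrow> (nat \<Rightarrow> rat) \<Rightarrow> nat \<Rightarrow> rat list" where
  "v_block N b k =
     (if k = N then replicate (N - 1) 1
      else map (\<lambda>i. (param_B N b k + of_nat i) / of_nat (N - k)) [0..<N - k])"

definition u_params :: "nat \<Rightarrow> (nat \<Rightarrow> rat) \<Rightarrow> rat list" where
  "u_params N b = concat (map (u_block N b) [1..<N + 1])"

definition v_params :: "nat \<Rightarrow> (nat \<Rightarrow> rat) \<Rightarrow> rat list" where
  "v_params N b = concat (map (v_block N b) [1..<N + 1])"

text \<open>
  \<^const>\<open>fps_hypergeo\<close> divides by zero (with value zero) when a lower parameter is a nonpositive
  integer, so definedness of the series has to be required separately.
\<close>

definition hypergeo_defined :: "rat list \<Rightarrow> bool" where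
  "hypergeo_defined bs \<longleftrightarrow> (\<forall>b\<in>set bs. \<forall>j::nat. b + of_nat j \<noteq> 0)"

lemma length_u_params: "length (u_params N b) = N * (N + 1) div 2"
proof -
  have "length (u_params N b) = (\<Sum>k=1..N. N - k + 1)"
    by (simp add: u_params_def u_block_def length_concat comp_def
        interv_sum_list_conv_sum_set_nat atLeastLessThanSuc_atLeastAtMost del: upt_Suc)
  also have "\<dots> = (\<Sum>k=1..N. k)"
    by (rule sum.reindex_bij_witness[where i = "\<lambda>k. N - k + 1" and j = "\<lambda>k. N - k + 1"]) auto
  also have "\<dots> = N * (N + 1) div 2"
    using Sum_Icc_nat[of 1 N] by simp
  finally show ?thesis .
qed

lemma length_v_params:
  assumes "N \<ge> 1"
  shows "length (v_params N b) = N * (N + 1) div 2 - 1"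
proof -
  have len: "length (v_block N b k) = (N - k) + (if k = N then N - 1 else 0)" for k
    by (simp add: v_block_def)
  have "length (v_params N b) = (\<Sum>k=1..N. length (v_block N b k))"
    by (simp add: v_params_def length_concat comp_def
        interv_sum_list_conv_sum_set_nat atLeastLessThanSuc_atLeastAtMost del: upt_Suc)
  also have "\<dots> = (\<Sum>k=1..N. N - k) + (N - 1)"
    unfolding len sum.distrib using assms by simp
  finally have 1: "length (v_params N b) = (\<Sum>k=1..N. N - k) + (N - 1)" .
  have "(\<Sum>k=1..N. N - k + 1) = (\<Sum>k=1..N. k)"
    by (rule sum.reindex_bij_witness[where i = "\<lambda>k. N - k + 1" and j = "\<lambda>k. N - k + 1"]) auto
  then have "(\<Sum>k=1..N. N - k) + N = N * (N + 1) div 2"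
    using Sum_Icc_nat[of 1 N] by (simp add: sum_Suc)
  then show ?thesis using 1 assms by linarith
qed

end

theory Submission
  imports Defs
begin

text \<open>
  Write \<open>S k = 1 + x\<^sub>1 + \<dots> + x\<^sub>k\<close>. Since \<open>S k = S (k - 1) (1 + x\<^sub>k / S (k - 1))\<close>, the coefficient of
  \<open>x\<^sub>k ^ m\<close> in \<open>S k ^ a\<close> is \<open>(a gchoose m) S (k - 1) ^ (a - m)\<close>, which merges into the factor with
  index \<open>k - 1\<close>. Extracting \<open>x\<^sub>N, \<dots>, x\<^sub>1\<close> in turn shows that the \<open>n\<close>-th diagonal coefficient is the
  product over \<open>k\<close> of \<open>(- B k - (N - k) n) gchoose n\<close>. Each factor is, up to sign,
  \<open>pochhammer (B k) ((N - k + 1) n) / (pochhammer (B k) ((N - k) n) n!)\<close>, and the multiplication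
  formula for Pochhammer symbols turns numerator and denominator into the blocks \<open>u\<^sup>k\<close> and \<open>v\<^sup>k\<close>;
  the powers it produces telescope to \<open>N ^ (N n)\<close>.
\<close>

section \<open>Coefficients of sums, products and single variables\<close>

lemma mdegree_single: "mdegree (Poly_Mapping.single i j) = j"
  by (simp add: mdegree_def)

lemma mfps_coeff_sum: "mfps_coeff (sum f A) m = (\<Sum>i\<in>A. mfps_coeff (f i) m)"
  by (induction A rule: infinite_finite_induct) (simp_all add: zero_mfps.rep_eq plus_mfps.rep_eq)

lemma mfps_coeff_of_nat_mult:
  "mfps_coeff (of_nat n * f) m = of_nat n * mfps_coeff f m"
  by (induction n) (simp_all add: zero_mfps.rep_eq plus_mfps.rep_eq distrib_right)

lemma mfps_coeff_mult:
  "mfps_coeff (f * g) m = (\<Sum>(p, q)\<in>splits m. mfps_coeff f p * mfps_coeff g q)"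
  by (simp add: times_mfps.rep_eq)

lemma mfps_coeff_var_mult:
  "mfps_coeff (mfps_var i * f) (Poly_Mapping.single i 1 + m) = mfps_coeff f m"
proof -
  let ?x = "Poly_Mapping.single i (1::nat)"
  have "mfps_coeff (mfps_var i * f) (?x + m) =
      (\<Sum>(p, q)\<in>{(?x, m)}. mfps_coeff (mfps_var i) p * mfps_coeff f q)"
    unfolding mfps_coeff_mult
    by (rule sum.mono_neutral_right) (auto simp: mfps_var.rep_eq split: if_splits)
  then show ?thesis by (simp add: mfps_var.rep_eq)
qed

lemma mfps_coeff_var_mult_eq_0:
  assumes "Poly_Mapping.lookup m i = 0"
  shows "mfps_coeff (mfps_var i * f) m = 0"
  unfolding mfps_coeff_mult
proof (intro sum.neutral ballI, clarify)
  fix p q assume m: "m = p + q"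
  have "p \<noteq> Poly_Mapping.single i 1"
    using assms by (auto simp: m lookup_add)
  then show "mfps_coeff (mfps_var i) p * mfps_coeff f q = 0"
    by (simp add: mfps_var.rep_eq)
qed

section \<open>Series not involving a given variable\<close>

definition mfps_indep :: "'v \<Rightarrow> ('v, 'a :: comm_ring_1) mfps \<Rightarrow> bool" where
  "mfps_indep i f \<longleftrightarrow> (\<forall>m. Poly_Mapping.lookup m i \<noteq> 0 \<longrightarrow> mfps_coeff f m = 0)"

lemma mfps_indep_1: "mfps_indep i 1"
  by (auto simp: mfps_indep_def one_mfps.rep_eq)

lemma mfps_indep_add: "mfps_indep i f \<Longrightarrow> mfps_indep i g \<Longrightarrow> mfps_indep i (f + g)"
  by (auto simp: mfps_indep_def plus_mfps.rep_eq)

lemma mfps_indep_diff: "mfps_indep i f \<Longrightarrow> mfps_indep i g \<Longrightarrow> mfps_indep i (f - g)"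
  by (auto simp: mfps_indep_def minus_mfps.rep_eq)

lemma mfps_indep_sum: "(\<And>j. j \<in> A \<Longrightarrow> mfps_indep i (f j)) \<Longrightarrow> mfps_indep i (sum f A)"
  by (auto simp: mfps_indep_def mfps_coeff_sum)

lemma mfps_indep_var: "i \<noteq> j \<Longrightarrow> mfps_indep i (mfps_var j)"
  by (auto simp: mfps_indep_def mfps_var.rep_eq lookup_single_not_eq)

lemma mfps_indep_mult:
  fixes f g :: "('v, 'a :: comm_ring_1) mfps"
  assumes "mfps_indep i f" "mfps_indep i g"
  shows "mfps_indep i (f * g)"
proof -
  have "mfps_coeff f p * mfps_coeff g q = 0" if "Poly_Mapping.lookup (p + q) i \<noteq> 0" for p q
  proof -
    have "Poly_Mapping.lookup p i \<noteq> 0 \<or> Poly_Mapping.lookup q i \<noteq> 0"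
      using that by (auto simp: lookup_add)
    then show ?thesis
      using assms by (auto simp: mfps_indep_def)
  qed
  then show ?thesis
    by (auto simp: mfps_indep_def[of i "f * g"] mfps_coeff_mult intro!: sum.neutral)
qed

lemma mfps_indep_power: "mfps_indep i f \<Longrightarrow> mfps_indep i (f ^ n)"
  by (induction n) (simp_all add: mfps_indep_1 mfps_indep_mult)

lemma mfps_indep_prod: "(\<And>j. j \<in> A \<Longrightarrow> mfps_indep i (f j)) \<Longrightarrow> mfps_indep i (prod f A)"
  by (induction A rule: infinite_finite_induct) (simp_all add: mfps_indep_1 mfps_indep_mult)

lemma mfps_indep_rpower:
  assumes "mfps_indep i f"
  shows "mfps_indep i (mfps_rpower f a)"
proof -
  have "mfps_indep i ((f - 1) ^ j)" for j
    by (intro mfps_indep_power mfps_indep_diff mfps_indep_1 assms)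
  then show ?thesis
    by (auto simp: mfps_indep_def mfps_rpower_def Abs_mfps_inverse)
qed

section \<open>Extracting a power of one variable\<close>

text \<open>As neither \<open>f\<close> nor \<open>p\<close> involves the variable \<open>i\<close>,
  its whole exponent \<open>j\<close> must come from \<open>g\<close>; the splittings that
  contribute therefore correspond to those of \<open>p\<close>.\<close>

lemma mfps_coeff_indep_mult:
  assumes "mfps_indep i f" "Poly_Mapping.lookup p i = 0"
  shows "mfps_coeff (f * g) (p + Poly_Mapping.single i j) =
    (\<Sum>(q, r)\<in>splits p. mfps_coeff f q * mfps_coeff g (r + Poly_Mapping.single i j))"
proof -
  let ?x = "Poly_Mapping.single i j"
  let ?h = "\<lambda>(q, r). (q, r + ?x)"
  have inj: "inj_on ?h (splits p)"
    by (auto intro!: inj_onI)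
  have out: "mfps_coeff f q = 0" if eq: "q + r = p + ?x" and notin: "(q, r) \<notin> ?h ` splits p" for q r
  proof (rule ccontr)
    assume "mfps_coeff f q \<noteq> 0"
    then have "Poly_Mapping.lookup q i = 0"
      using assms(1) by (auto simp: mfps_indep_def)
    then have "Poly_Mapping.lookup r i = j"
      using arg_cong[OF eq, of "\<lambda>m. Poly_Mapping.lookup m i"] assms(2) by (simp add: lookup_add)
    \<comment> \<open>The truncated subtraction loses nothing, since \<open>r\<close> has exponent
      exactly \<open>j\<close> at \<open>i\<close>.\<close>
    then have r: "r = (r - ?x) + ?x"
      by (intro poly_mapping_eqI) (auto simp: lookup_add lookup_minus lookup_single when_def)
    then have "q + (r - ?x) + ?x = p + ?x"
      using eq by (simp add: add.assoc)
    then have "q + (r - ?x) = p" by simp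
    then have "(q, (r - ?x) + ?x) \<in> ?h ` splits p" by force
    then show False using notin r by simp
  qed
  have "mfps_coeff (f * g) (p + ?x) =
      (\<Sum>(q, r)\<in>?h ` splits p. mfps_coeff f q * mfps_coeff g r)"
    unfolding mfps_coeff_mult
  proof (rule sum.mono_neutral_right)
    show "?h ` splits p \<subseteq> splits (p + ?x)"
      by (auto simp: add.assoc)
  qed (use out in auto)
  also have "\<dots> = (\<Sum>(q, r)\<in>splits p. mfps_coeff f q * mfps_coeff g (r + ?x))"
    by (subst sum.reindex[OF inj]) (simp add: case_prod_unfold)
  finally show ?thesis .
qed

lemma mfps_coeff_var_power_mult:
  assumes "mfps_indep i f" "Poly_Mapping.lookup p i = 0"
  shows "mfps_coeff (mfps_var i ^ n * f) (p + Poly_Mapping.single i j) =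
    (if n = j then mfps_coeff f p else 0)"
proof (induction n arbitrary: j)
  case 0
  then show ?case
    using assms by (auto simp: mfps_indep_def lookup_add)
next
  case (Suc n)
  show ?case
  proof (cases j)
    case 0
    then show ?thesis
      using assms(2) by (simp add: mult.assoc mfps_coeff_var_mult_eq_0)
  next
    case (Suc k)
    have "p + Poly_Mapping.single i j = Poly_Mapping.single i 1 + (p + Poly_Mapping.single i k)"
      by (simp add: Suc single_add[symmetric] add.left_commute)
    then show ?thesis
      using Suc.IH[of k] by (simp add: mult.assoc mfps_coeff_var_mult Suc del: One_nat_def)
  qed
qed

text \<open>In the binomial expansion only the term with the \<open>j\<close>-th power of the
  variable has exponent \<open>j\<close> there. For \<open>j > n\<close> the truncated
  \<open>n - j\<close> does no harm, because \<open>n choose j\<close> vanishes.\<close>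

lemma mfps_coeff_add_var_power:
  assumes "mfps_indep i f" "Poly_Mapping.lookup p i = 0"
  shows "mfps_coeff ((f + mfps_var i) ^ n) (p + Poly_Mapping.single i j) =
    of_nat (n choose j) * mfps_coeff (f ^ (n - j)) p"
proof -
  have "(f + mfps_var i) ^ n = (\<Sum>k\<le>n. of_nat (n choose k) * (mfps_var i ^ k * f ^ (n - k)))"
    by (subst add.commute, subst binomial_ring) (simp add: mult.assoc)
  then have "mfps_coeff ((f + mfps_var i) ^ n) (p + Poly_Mapping.single i j) =
      (\<Sum>k\<le>n. of_nat (n choose k) * (if k = j then mfps_coeff (f ^ (n - k)) p else 0))"
    using assms by (simp add: mfps_coeff_sum mfps_coeff_of_nat_mult mfps_coeff_var_power_mult
        mfps_indep_power)
  also have "\<dots> = (\<Sum>k\<le>n. if k = j then of_nat (n choose j) * mfps_coeff (f ^ (n - j)) p else 0)"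
    by (intro sum.cong) auto
  also have "\<dots> = of_nat (n choose j) * mfps_coeff (f ^ (n - j)) p"
    by (simp add: sum.delta binomial_eq_0)
  finally show ?thesis .
qed

section \<open>Powers with arbitrary exponents\<close>

text \<open>A cutoff \<open>D\<close> independent of \<open>m\<close> is what a product requires:
  all splittings of one exponent can then share the same range of summation.\<close>

lemma mfps_coeff_rpower_bound:
  assumes "mfps_coeff f 0 = 1" "mdegree m \<le> D"
  shows "mfps_coeff (mfps_rpower f a) m =
    (\<Sum>j\<le>D. (a gchoose j) * mfps_coeff ((f - 1) ^ j) m)"
proof -
  have "mfps_coeff (f - 1) 0 = 0"
    using assms by (simp add: minus_mfps.rep_eq one_mfps.rep_eq)
  then show ?thesis
    unfolding mfps_coeff_rpower[OF assms(1)] using assms(2)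
    by (intro sum.mono_neutral_left) (auto simp: mfps_coeff_power_eq_0)
qed

lemma mfps_coeff_rpower_Sum_any:
  "mfps_coeff (mfps_rpower f a) m = Sum_any (\<lambda>j. (a gchoose j) * mfps_coeff ((f - 1) ^ j) m)"
  by (simp add: mfps_rpower_def Abs_mfps_inverse)

lemma mfps_rpower_0: "mfps_rpower f 0 = 1"
proof (rule mfps_eqI)
  fix m
  have eq: "(0 gchoose j) * mfps_coeff ((f - 1) ^ j) m = (if j = 0 then mfps_coeff 1 m else 0)" for j
    by (cases j) auto
  show "mfps_coeff (mfps_rpower f 0) m = mfps_coeff 1 m"
    unfolding mfps_coeff_rpower_Sum_any eq by (subst Sum_any.expand_superset[of "{0}"]) auto
qed

lemma mfps_rpower_1_left: "mfps_rpower 1 a = (1 :: ('v, 'a :: field_char_0) mfps)"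
proof (rule mfps_eqI)
  fix m :: "'v \<Rightarrow>\<^sub>0 nat"
  have eq: "(a gchoose j) * mfps_coeff ((1 - 1) ^ j) m = (if j = 0 then mfps_coeff 1 m else 0)" for j
    by (cases j) (auto simp: zero_mfps.rep_eq)
  show "mfps_coeff (mfps_rpower 1 a) m = mfps_coeff 1 m"
    unfolding mfps_coeff_rpower_Sum_any eq by (subst Sum_any.expand_superset[of "{0}"]) auto
qed

text \<open>Multiply the two binomial series in \<open>f - 1\<close> and collect equal powers; the
  coefficients combine by Vandermonde's identity.\<close>

lemma mfps_rpower_add:
  assumes "mfps_coeff f 0 = 1"
  shows "mfps_rpower f (a + b) = mfps_rpower f a * mfps_rpower f b"
proof (rule mfps_eqI)
  fix m :: "'b \<Rightarrow>\<^sub>0 nat"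
  define L where "L = f - 1"
  define D where "D = mdegree m"
  have L0: "mfps_coeff L 0 = 0"
    using assms by (simp add: L_def minus_mfps.rep_eq one_mfps.rep_eq)
  have bound: "j \<le> D" if "mfps_coeff (L ^ j) m \<noteq> 0" for j
    using mfps_coeff_power_eq_0[OF L0] that unfolding D_def by (metis not_le)
  let ?t = "\<lambda>j k. (a gchoose j) * (b gchoose k) * mfps_coeff (L ^ (j + k)) m"
  have "mfps_coeff (mfps_rpower f a * mfps_rpower f b) m = (\<Sum>(p, q)\<in>splits m.
      (\<Sum>j\<le>D. (a gchoose j) * mfps_coeff (L ^ j) p) * (\<Sum>k\<le>D. (b gchoose k) * mfps_coeff (L ^ k) q))"
    unfolding mfps_coeff_mult L_def D_def
    by (intro sum.cong refl)
      (auto simp: assms mdegree_add mfps_coeff_rpower_bound[where D = "mdegree m"])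
  also have "\<dots> = (\<Sum>s\<in>splits m. \<Sum>j\<le>D. \<Sum>k\<le>D.
      (a gchoose j) * (b gchoose k) * (mfps_coeff (L ^ j) (fst s) * mfps_coeff (L ^ k) (snd s)))"
    by (simp add: sum_product case_prod_unfold mult_ac)
  also have "\<dots> = (\<Sum>j\<le>D. \<Sum>k\<le>D. \<Sum>s\<in>splits m.
      (a gchoose j) * (b gchoose k) * (mfps_coeff (L ^ j) (fst s) * mfps_coeff (L ^ k) (snd s)))"
    by (subst sum.swap, rule sum.cong[OF refl], rule sum.swap)
  also have "\<dots> = (\<Sum>j\<le>D. \<Sum>k\<le>D. ?t j k)"
    by (simp add: power_add mfps_coeff_mult sum_distrib_left case_prod_unfold)
  also have "\<dots> = (\<Sum>(j, k)\<in>{..D} \<times> {..D}. ?t j k)"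
    by (rule sum.cartesian_product)
  \<comment> \<open>The square can be cut down to a triangle because \<open>L ^ (j + k)\<close> has
    no coefficient at \<open>m\<close> once \<open>j + k\<close> exceeds its degree.\<close>
  also have "\<dots> = (\<Sum>(j, k)\<in>{(j, k). j + k \<le> D}. ?t j k)"
    by (intro sum.mono_neutral_right) (auto dest: bound)
  also have "\<dots> = (\<Sum>n\<le>D. \<Sum>j\<le>n. ?t j (n - j))"
    by (rule sum.triangle_reindex_eq)
  also have "\<dots> = (\<Sum>n\<le>D. ((a + b) gchoose n) * mfps_coeff (L ^ n) m)"
    by (intro sum.cong refl)
      (simp add: gbinomial_Vandermonde[symmetric] atLeast0AtMost sum_distrib_right)
  also have "\<dots> = mfps_coeff (mfps_rpower f (a + b)) m"
    by (simp add: mfps_coeff_rpower assms D_def L_def)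
  finally show "mfps_coeff (mfps_rpower f (a + b)) m = mfps_coeff (mfps_rpower f a * mfps_rpower f b) m" ..
qed

lemma mfps_coeff_var_0: "mfps_coeff (mfps_var i) 0 = 0"
proof -
  have "0 \<noteq> Poly_Mapping.single i (1::nat)"
    by (metis lookup_single_eq lookup_zero zero_neq_one)
  then show ?thesis by (simp add: mfps_var.rep_eq)
qed

text \<open>By trinomial revision, \<open>(a gchoose n) * (n choose j)\<close> equals
  \<open>(a gchoose j) * (a - j gchoose (n - j))\<close>, so after shifting \<open>n\<close> by
  \<open>j\<close> the binomial series of \<open>f\<close> with exponent \<open>a - j\<close>
  remains.\<close>

lemma mfps_coeff_rpower_add_var:
  assumes "mfps_coeff f 0 = 1" "mfps_indep i f" "Poly_Mapping.lookup p i = 0"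
  shows "mfps_coeff (mfps_rpower (f + mfps_var i) a) (p + Poly_Mapping.single i j) =
    (a gchoose j) * mfps_coeff (mfps_rpower f (a - of_nat j)) p"
proof -
  define L where "L = f - 1"
  have L: "mfps_indep i L"
    unfolding L_def by (intro mfps_indep_diff mfps_indep_1 assms)
  have deg: "mdegree (p + Poly_Mapping.single i j) = j + mdegree p"
    by (simp add: mdegree_add mdegree_single)
  have const: "mfps_coeff (f + mfps_var i) 0 = 1"
    using assms(1) by (simp add: plus_mfps.rep_eq mfps_coeff_var_0)
  have L_var: "f + mfps_var i - 1 = L + mfps_var i"
    by (simp add: L_def)
  have "mfps_coeff (mfps_rpower (f + mfps_var i) a) (p + Poly_Mapping.single i j) =
      (\<Sum>n\<le>j + mdegree p. (a gchoose n) * (of_nat (n choose j) * mfps_coeff (L ^ (n - j)) p))"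
    unfolding mfps_coeff_rpower[OF const] deg L_var mfps_coeff_add_var_power[OF L assms(3)] ..
  \<comment> \<open>Terms with \<open>n < j\<close> drop out through \<open>n choose j\<close>, so
    from here on \<open>n - j\<close> is a true difference.\<close>
  also have "\<dots> = (\<Sum>n\<in>{j..j + mdegree p}.
      (a gchoose n) * (of_nat (n choose j) * mfps_coeff (L ^ (n - j)) p))"
    by (rule sum.mono_neutral_right) auto
  also have "\<dots> = (\<Sum>n\<in>{j..j + mdegree p}.
      (a gchoose j) * ((a - of_nat j gchoose (n - j)) * mfps_coeff (L ^ (n - j)) p))"
  proof (rule sum.cong[OF refl])
    fix n assume "n \<in> {j..j + mdegree p}"
    then have "(a gchoose n) * of_nat (n choose j) = (a gchoose j) * (a - of_nat j gchoose (n - j))"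
      using gbinomial_trinomial_revision[of j n a] by (simp add: binomial_gbinomial)
    then show "(a gchoose n) * (of_nat (n choose j) * mfps_coeff (L ^ (n - j)) p) =
        (a gchoose j) * ((a - of_nat j gchoose (n - j)) * mfps_coeff (L ^ (n - j)) p)"
      by (simp flip: mult.assoc)
  qed
  also have "\<dots> = (\<Sum>n\<le>mdegree p.
      (a gchoose j) * ((a - of_nat j gchoose n) * mfps_coeff (L ^ n) p))"
    by (rule sum.reindex_bij_witness[where i = "\<lambda>n. n + j" and j = "\<lambda>n. n - j"]) auto
  also have "\<dots> = (a gchoose j) * mfps_coeff (mfps_rpower f (a - of_nat j)) p"
    by (simp add: mfps_coeff_rpower assms(1) L_def sum_distrib_left)
  finally show ?thesis .
qed

text \<open>The extra factor with exponent \<open>c\<close> collects what earlier extractions leave behind.\<close>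

lemma mfps_coeff_prod_rpower:
  fixes b :: "nat \<Rightarrow> 'a :: field_char_0"
  defines "S \<equiv> \<lambda>k. 1 + (\<Sum>i=1..k. mfps_var i)"
  shows "mfps_coeff ((\<Prod>k=1..N. mfps_rpower (S k) (b k)) * mfps_rpower (S N) c)
      (\<Sum>i=1..N. Poly_Mapping.single i (m i)) =
    (\<Prod>k=1..N. (c + (\<Sum>i=k..N. b i) - of_nat (\<Sum>i=Suc k..N. m i)) gchoose m k)"
proof (induction N arbitrary: c)
  case 0
  then show ?case by (simp add: S_def mfps_rpower_1_left one_mfps.rep_eq)
next
  case (Suc N)
  define P where "P = (\<Prod>k=1..N. mfps_rpower (S k) (b k))"
  define p where "p = (\<Sum>i=1..N. Poly_Mapping.single i (m i))"
  \<comment> \<open>The total exponent of \<open>S (Suc N)\<close> once the extra factor is merged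
    with the last one.\<close>
  define d where "d = b (Suc N) + c"
  have S0: "mfps_coeff (S k) 0 = 1" for k
    by (simp add: S_def plus_mfps.rep_eq one_mfps.rep_eq mfps_coeff_sum mfps_coeff_var_0)
  have SSuc: "S (Suc N) = S N + mfps_var (Suc N)"
    by (simp add: S_def add_ac)
  have indep: "mfps_indep (Suc N) (S k)" if "k \<le> N" for k
    unfolding S_def using that
    by (intro mfps_indep_add mfps_indep_1 mfps_indep_sum mfps_indep_var) auto
  have P: "mfps_indep (Suc N) P"
    unfolding P_def by (intro mfps_indep_prod mfps_indep_rpower indep) auto
  have p: "Poly_Mapping.lookup p (Suc N) = 0"
    by (auto simp: p_def lookup_sum lookup_single when_def)
  have "mfps_coeff ((\<Prod>k=1..Suc N. mfps_rpower (S k) (b k)) * mfps_rpower (S (Suc N)) c)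
      (\<Sum>i=1..Suc N. Poly_Mapping.single i (m i)) =
      mfps_coeff (P * mfps_rpower (S (Suc N)) d) (p + Poly_Mapping.single (Suc N) (m (Suc N)))"
    by (simp add: P_def p_def d_def mfps_rpower_add[OF S0] mult.assoc)
  also have "\<dots> = (\<Sum>(q, r)\<in>splits p. mfps_coeff P q *
      mfps_coeff (mfps_rpower (S N + mfps_var (Suc N)) d)
        (r + Poly_Mapping.single (Suc N) (m (Suc N))))"
    unfolding SSuc by (rule mfps_coeff_indep_mult[OF P p])
  also have "\<dots> = (\<Sum>(q, r)\<in>splits p. (d gchoose m (Suc N)) * (mfps_coeff P q *
      mfps_coeff (mfps_rpower (S N) (d - of_nat (m (Suc N)))) r))"
  proof (intro sum.cong refl, clarify)
    fix q r assume pq: "p = q + r"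
    have "Poly_Mapping.lookup r (Suc N) = 0"
      using p by (simp add: pq lookup_add)
    then show "mfps_coeff P q * mfps_coeff (mfps_rpower (S N + mfps_var (Suc N)) d)
          (r + Poly_Mapping.single (Suc N) (m (Suc N))) =
        (d gchoose m (Suc N)) * (mfps_coeff P q *
          mfps_coeff (mfps_rpower (S N) (d - of_nat (m (Suc N)))) r)"
      by (simp add: mfps_coeff_rpower_add_var S0 indep)
  qed
  also have "\<dots> = (d gchoose m (Suc N)) *
      mfps_coeff (P * mfps_rpower (S N) (d - of_nat (m (Suc N)))) p"
    by (simp add: mfps_coeff_mult sum_distrib_left case_prod_unfold)
  also have "\<dots> = (d gchoose m (Suc N)) * (\<Prod>k=1..N. (d - of_nat (m (Suc N)) +
      (\<Sum>i=k..N. b i) - of_nat (\<Sum>i=Suc k..N. m i)) gchoose m k)"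
    \<comment> \<open>The induction hypothesis is used with \<open>d - of_nat (m (Suc N))\<close> in
      place of \<open>c\<close>: this is the exponent handed down to \<open>S N\<close>.\<close>
    unfolding P_def p_def Suc.IH ..
  also have "(\<Prod>k=1..N. (d - of_nat (m (Suc N)) +
      (\<Sum>i=k..N. b i) - of_nat (\<Sum>i=Suc k..N. m i)) gchoose m k) =
      (\<Prod>k=1..N. (c + (\<Sum>i=k..Suc N. b i) - of_nat (\<Sum>i=Suc k..Suc N. m i)) gchoose m k)"
    by (intro prod.cong refl arg_cong2[where f = gbinomial]) (simp add: d_def)
  also have "(d gchoose m (Suc N)) * \<dots> = (\<Prod>k=1..Suc N.
      (c + (\<Sum>i=k..Suc N. b i) - of_nat (\<Sum>i=Suc k..Suc N. m i)) gchoose m k)"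
    by (simp add: d_def add.commute mult.commute)
  finally show ?case .
qed

text \<open>On the diagonal every exponent is \<open>n\<close>, so the variables after
  \<open>x_k\<close> lower the upper entry of the \<open>k\<close>-th binomial by
  \<open>(N - k) * n\<close>. The extra factor has exponent 0.\<close>

lemma mfps_diag_R_nth:
  "fps_nth (mfps_diag {1..N} (diag_R N b)) n =
    (\<Prod>k=1..N. (- param_B N b k - of_nat ((N - k) * n)) gchoose n)"
  using mfps_coeff_prod_rpower[of b N 0 "\<lambda>_. n"]
  by (simp add: mfps_diag_def diag_R_def param_B_def mfps_rpower_0)

section \<open>Pochhammer symbols and the parameter blocks\<close>

text \<open>Raising \<open>n\<close> by one adds \<open>p\<close> consecutive factors
  \<open>x + p * n + i\<close>, each equal to \<open>p\<close> times
  \<open>(x + i) / p + n\<close>.\<close>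

lemma pochhammer_mult:
  fixes x :: "'a :: field_char_0"
  assumes "p > 0"
  shows "pochhammer x (p * n) =
    of_nat p ^ (p * n) * (\<Prod>i<p. pochhammer ((x + of_nat i) / of_nat p) n)"
proof (induction n)
  case (Suc n)
  have "pochhammer x (p * Suc n) = pochhammer x (p * n) * pochhammer (x + of_nat (p * n)) p"
    by (simp add: pochhammer_product' add.commute[of p])
  also have "pochhammer (x + of_nat (p * n)) p =
      (\<Prod>i<p. of_nat p * ((x + of_nat i) / of_nat p + of_nat n))"
    unfolding pochhammer_prod atLeast0LessThan
    using assms by (intro prod.cong) (auto simp: field_simps)
  also have "\<dots> = of_nat p ^ p * (\<Prod>i<p. (x + of_nat i) / of_nat p + of_nat n)"
    by (simp add: prod.distrib)
  finally show ?case
    unfolding Suc.IH by (simp add: pochhammer_Suc prod.distrib power_add mult_ac)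
qed simp

text \<open>The coefficients of \<open>fps_hypergeo\<close> are given by \<open>foldl\<close>; as
  list products they can be split into blocks.\<close>

lemma foldl_mult_prod_list:
  "foldl (\<lambda>r x. r * f x) (c :: 'a :: comm_monoid_mult) xs = c * prod_list (map f xs)"
  by (induction xs arbitrary: c) (simp_all add: mult.assoc)

lemma prod_list_map_concat:
  "prod_list (map f (concat xss)) =
    (prod_list (map (\<lambda>xs. prod_list (map f xs)) xss) :: 'a :: comm_monoid_mult)"
  by (induction xss) simp_all

lemma prod_list_map_concat_upt:
  fixes f :: "'b \<Rightarrow> 'a :: comm_monoid_mult"
  shows "prod_list (map f (concat (map g [1..<N + 1]))) = (\<Prod>k=1..N. prod_list (map f (g k)))"
  by (simp add: prod_list_map_concat comp_def prod.distinct_set_conv_list[symmetric]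
      atLeastLessThanSuc_atLeastAtMost del: upt_Suc)


lemma prod_list_map_upt: "prod_list (map f [0..<n]) = (\<Prod>i<n. f i :: 'a :: comm_monoid_mult)"
  by (simp add: prod.distinct_set_conv_list[symmetric] atLeast0LessThan)

lemma pochhammer_u_block:
  "pochhammer (param_B N b k) ((N - k + 1) * n) =
    of_nat (N - k + 1) ^ ((N - k + 1) * n) * prod_list (map (\<lambda>x. pochhammer x n) (u_block N b k))"
  unfolding u_block_def map_map comp_def prod_list_map_upt by (rule pochhammer_mult) simp

lemma pochhammer_v_block:
  assumes "k < N"
  shows "pochhammer (param_B N b k) ((N - k) * n) =
    of_nat (N - k) ^ ((N - k) * n) * prod_list (map (\<lambda>x. pochhammer x n) (v_block N b k))"
proof -
  have "v_block N b k = map (\<lambda>i. (param_B N b k + of_nat i) / of_nat (N - k)) [0..<N - k]"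
    using assms by (simp add: v_block_def)
  then show ?thesis
    using pochhammer_mult[of "N - k" "param_B N b k" n] assms
    by (simp add: comp_def prod_list_map_upt)
qed

text \<open>A Pochhammer symbol can vanish only at a nonpositive integer, which
  \<open>hypergeo_defined\<close> excludes. This permits division by the lower parameters.\<close>

lemma prod_pochhammer_neq_0:
  assumes "hypergeo_defined bs"
  shows "prod_list (map (\<lambda>x. pochhammer x n) bs) \<noteq> 0"
  using assms by (auto simp: hypergeo_defined_def prod_list_zero_iff pochhammer_eq_0_iff
      eq_neg_iff_add_eq_0)

section \<open>Comparing the coefficients of both series\<close>

theorem theorem3:
  fixes N :: nat and b :: "nat \<Rightarrow> rat"
  assumes "N \<ge> 1"
    and "b N \<noteq> 0"
    and "hypergeo_defined (v_params N b)"
  shows "mfps_diag {1..N} (diag_R N b) =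
           fps_hypergeo (u_params N b) (v_params N b) ((- of_nat N) ^ N)"
proof (rule fps_ext)
  fix n
  define U where "U k = prod_list (map (\<lambda>x. pochhammer x n) (u_block N b k))" for k
  define V where "V k = prod_list (map (\<lambda>x. pochhammer x n) (v_block N b k))" for k
  \<comment> \<open>The block \<open>v\<^sup>N\<close> of ones plays a different role: it supplies the factor \<open>(n!)\<^sup>N\<^sup>-\<^sup>1\<close>.\<close>
  define W where "W k = (if k = N then 1 else V k)" for k
  \<comment> \<open>The scaling factor of the multiplication formula with \<open>q\<close> blocks.
    Since \<open>0 ^ 0 = 1\<close>, \<open>e 0 = 1\<close>, which covers \<open>k = N\<close> and
    starts the telescoping product.\<close>
  define e :: "nat \<Rightarrow> rat" where "e q = of_nat q ^ (q * n)" for q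
  have e: "e q \<noteq> 0" for q
    by (cases q) (simp_all add: e_def)
  have V: "V k \<noteq> 0" if "k \<in> {1..N}" for k
    unfolding V_def
  proof (rule prod_pochhammer_neq_0)
    show "hypergeo_defined (v_block N b k)"
      using assms(3) that
      by (auto simp: hypergeo_defined_def v_params_def atLeastLessThanSuc_atLeastAtMost
          simp del: upt_Suc)
  qed
  have factor: "((- param_B N b k - of_nat ((N - k) * n)) gchoose n) =
      (- 1) ^ n / fact n * (e (N - k + 1) / e (N - k)) * (U k / W k)" if k: "k \<in> {1..N}" for k
  proof -
    have "pochhammer (param_B N b k) ((N - k) * n) = e (N - k) * W k"
      using k pochhammer_v_block[of k N b n] by (cases "k = N") (auto simp: e_def V_def W_def)
    moreover have "pochhammer (param_B N b k) ((N - k + 1) * n) = e (N - k + 1) * U k"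
      unfolding e_def U_def by (rule pochhammer_u_block)
    \<comment> \<open>Splitting off the last \<open>n\<close> factors exhibits the Pochhammer symbol
      of the binomial as a quotient of the two symbols above.\<close>
    moreover have "pochhammer (param_B N b k) ((N - k + 1) * n) =
        pochhammer (param_B N b k) ((N - k) * n) *
        pochhammer (param_B N b k + of_nat ((N - k) * n)) n"
      unfolding pochhammer_product'[symmetric] by (simp add: add.commute)
    ultimately have "pochhammer (param_B N b k + of_nat ((N - k) * n)) n =
        e (N - k + 1) * U k / (e (N - k) * W k)"
      using e V[OF k] by (simp add: W_def field_simps)
    moreover have "- (- param_B N b k - of_nat ((N - k) * n)) =
        param_B N b k + of_nat ((N - k) * n)"
      by simp
    ultimately show ?thesis
      unfolding gbinomial_pochhammer by (simp add: add.commute mult_ac)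
  qed
  have "(\<Prod>k=1..N. e (N - k + 1) / e (N - k)) = (\<Prod>q<N. e (Suc q) / e q)"
    by (rule prod.reindex_bij_witness[where i = "\<lambda>q. N - q" and j = "\<lambda>k. N - k"]) auto
  also have "\<dots> = e N"
    using prod_lessThan_telescope[of N e] e by (simp add: e_def)
  finally have tele: "(\<Prod>k=1..N. e (N - k + 1) / e (N - k)) = e N" .
  \<comment> \<open>The \<open>N - 1\<close> ones in the last block and the factorial built into the
    hypergeometric series give \<open>fact n ^ N\<close>, which matches the factorials of the
    \<open>N\<close> binomials.\<close>
  have "prod V {1..N} = V N * prod V ({1..N} - {N})"
    using assms(1) by (intro prod.remove) auto
  also have "prod V ({1..N} - {N}) = prod W ({1..N} - {N})"
    by (intro prod.cong) (auto simp: W_def)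
  also have "\<dots> = prod W {1..N}"
    using assms(1) by (subst prod.remove[of "{1..N}" N]) (auto simp: W_def)
  also have "V N = fact n ^ (N - 1)"
    by (simp add: V_def v_block_def pochhammer_fact[symmetric])
  finally have "prod V {1..N} * fact n = fact n ^ N * prod W {1..N}"
    using assms(1) by (cases N) (simp_all add: mult_ac)
  then have den: "foldl (\<lambda>r x. r * pochhammer x n) 1 (v_params N b) * of_nat (fact n) =
      fact n ^ N * prod W {1..N}"
    unfolding foldl_mult_prod_list v_params_def prod_list_map_concat_upt V_def by simp
  have num: "foldl (\<lambda>r x. r * pochhammer x n) 1 (u_params N b) = prod U {1..N}"
    unfolding foldl_mult_prod_list u_params_def prod_list_map_concat_upt U_def by simp
  have "fps_nth (mfps_diag {1..N} (diag_R N b)) n =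
      (\<Prod>k=1..N. (- 1) ^ n / fact n * (e (N - k + 1) / e (N - k)) * (U k / W k))"
    unfolding mfps_diag_R_nth by (rule prod.cong[OF refl factor])
  also have "\<dots> = ((- 1) ^ n / fact n) ^ N * e N * (prod U {1..N} / prod W {1..N})"
    unfolding prod.distrib tele by (simp add: prod_dividef)
  also have "\<dots> = prod U {1..N} * ((- of_nat N) ^ N) ^ n / (fact n ^ N * prod W {1..N})"
  proof -
    \<comment> \<open>The \<open>N\<close> binomials supply the sign and the telescoped
      \<open>e N\<close> the absolute value of the scaled argument's power.\<close>
    have "((- of_nat N) ^ N) ^ n = ((- 1) ^ n) ^ N * e N"
      by (simp add: e_def power_minus[of "of_nat N"] power_mult_distrib flip: power_mult)
        (simp add: mult.commute)
    then show ?thesis by (simp add: power_divide)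
  qed
  finally show "fps_nth (mfps_diag {1..N} (diag_R N b)) n =
      fps_nth (fps_hypergeo (u_params N b) (v_params N b) ((- of_nat N) ^ N)) n"
    unfolding fps_hypergeo_nth num den .
qed

end
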